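(* Let $\Lambda$ be an Artinian algebra and let $S$ be a faithful and simple left $\Lambda$-module. If $\operatorname{Ext}^1_\Lambda(S\oplus\Lambda,\,S\oplus\Lambda)=0$, then $S$ is projective.
   Context: An Artinian algebra (Artin algebra) is a ring $\Lambda$ whose center $R$ is a commutative Artinian ring and which is finitely generated as an $R$-module. A module is faithful if its annihilator in $\Lambda$ is zero. *)

theory Defs
  imports "HOL-Algebra.Module" "HOL-Algebra.Ideal" "HOL-Algebra.Elementary_Groups"
begin

section \<open>Left modules over a ring\<close>

text \<open>
  The library's locale \<^locale>\<open>module\<close> insists on a commutative ring of scalars. We keep its
  record type, whose fields \<open>mult\<close> and \<open>one\<close> play no role for modules, and its axioms.
\<close>

locale left_module = R?: ring R + M?: abelian_group M
  for R :: "('a, 'k) ring_scheme" (structure) and M :: "('a, 'b, 'm) module_scheme" (structure) +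
  assumes smult_closed [simp, intro]:
      "\<lbrakk>a \<in> carrier R; x \<in> carrier M\<rbrakk> \<Longrightarrow> a \<odot>\<^bsub>M\<^esub> x \<in> carrier M"
    and smult_l_distr:
      "\<lbrakk>a \<in> carrier R; b \<in> carrier R; x \<in> carrier M\<rbrakk> \<Longrightarrow>
        (a \<oplus> b) \<odot>\<^bsub>M\<^esub> x = a \<odot>\<^bsub>M\<^esub> x \<oplus>\<^bsub>M\<^esub> b \<odot>\<^bsub>M\<^esub> x"
    and smult_r_distr:
      "\<lbrakk>a \<in> carrier R; x \<in> carrier M; y \<in> carrier M\<rbrakk> \<Longrightarrow>
        a \<odot>\<^bsub>M\<^esub> (x \<oplus>\<^bsub>M\<^esub> y) = a \<odot>\<^bsub>M\<^esub> x \<oplus>\<^bsub>M\<^esub> a \<odot>\<^bsub>M\<^esub> y"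
    and smult_assoc1:
      "\<lbrakk>a \<in> carrier R; b \<in> carrier R; x \<in> carrier M\<rbrakk> \<Longrightarrow>
        (a \<otimes> b) \<odot>\<^bsub>M\<^esub> x = a \<odot>\<^bsub>M\<^esub> (b \<odot>\<^bsub>M\<^esub> x)"
    and smult_one [simp]:
      "x \<in> carrier M \<Longrightarrow> \<one> \<odot>\<^bsub>M\<^esub> x = x"

definition annihilator :: "('r, 'k) ring_scheme \<Rightarrow> ('r, 'm) module \<Rightarrow> 'r set"
  where "annihilator R M = {r \<in> carrier R. \<forall>x\<in>carrier M. r \<odot>\<^bsub>M\<^esub> x = \<zero>\<^bsub>M\<^esub>}"

definition faithful_module :: "('r, 'k) ring_scheme \<Rightarrow> ('r, 'm) module \<Rightarrow> bool"
  where "faithful_module R M \<longleftrightarrow> left_module R M \<and> annihilator R M = {\<zero>\<^bsub>R\<^esub>}"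

definition simple_module :: "('r, 'k) ring_scheme \<Rightarrow> ('r, 'm) module \<Rightarrow> bool"
  where "simple_module R M \<longleftrightarrow>
    left_module R M \<and> carrier M \<noteq> {\<zero>\<^bsub>M\<^esub>} \<and>
    (\<forall>N. submodule N R M \<longrightarrow> N = {\<zero>\<^bsub>M\<^esub>} \<or> N = carrier M)"

definition finitely_generated_module :: "('r, 'k) ring_scheme \<Rightarrow> ('r, 'm) module \<Rightarrow> bool"
  where "finitely_generated_module R M \<longleftrightarrow>
    left_module R M \<and>
    (\<exists>A. finite A \<and> A \<subseteq> carrier M \<and>
      (\<forall>x\<in>carrier M. \<exists>c\<in>A \<rightarrow> carrier R. x = (\<Oplus>\<^bsub>M\<^esub>a\<in>A. c a \<odot>\<^bsub>M\<^esub> a)))"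

text \<open>Linear maps are taken extensional, so that equal maps are equal HOL functions.\<close>

definition module_hom ::
    "('r, 'k) ring_scheme \<Rightarrow> ('r, 'm) module \<Rightarrow> ('r, 'n) module \<Rightarrow> ('m \<Rightarrow> 'n) set"
  where "module_hom R M N =
    {f \<in> carrier M \<rightarrow>\<^sub>E carrier N.
      (\<forall>x\<in>carrier M. \<forall>y\<in>carrier M. f (x \<oplus>\<^bsub>M\<^esub> y) = f x \<oplus>\<^bsub>N\<^esub> f y) \<and>
      (\<forall>r\<in>carrier R. \<forall>x\<in>carrier M. f (r \<odot>\<^bsub>M\<^esub> x) = r \<odot>\<^bsub>N\<^esub> f x)}"

text \<open>
  HOL cannot quantify over types inside a formula, so the types of the two test modules are
  parameters. A theorem concluding projectivity with these as free type variables asserts the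
  lifting property against all surjections of modules.
\<close>

definition projective_module ::
    "'x itself \<Rightarrow> 'y itself \<Rightarrow> ('r, 'k) ring_scheme \<Rightarrow> ('r, 'm) module \<Rightarrow> bool"
  where "projective_module (_ :: 'x itself) (_ :: 'y itself) R P \<longleftrightarrow>
    left_module R P \<and>
    (\<forall>(A :: ('r, 'x) module) (B :: ('r, 'y) module) g f.
      left_module R A \<longrightarrow> left_module R B \<longrightarrow>
      g \<in> module_hom R A B \<longrightarrow> g ` carrier A = carrier B \<longrightarrow> f \<in> module_hom R P B \<longrightarrow>
      (\<exists>h\<in>module_hom R P A. \<forall>p\<in>carrier P. g (h p) = f p))"

definition regular_module :: "('r, 'k) ring_scheme \<Rightarrow> ('r, 'r) module"
  where "regular_module R =
    \<lparr>carrier = carrier R, mult = mult R, one = \<one>\<^bsub>R\<^esub>, zero = \<zero>\<^bsub>R\<^esub>, add = add R,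
     smult = mult R\<rparr>"

definition direct_sum :: "('r, 'm) module \<Rightarrow> ('r, 'n) module \<Rightarrow> ('r, 'm \<times> 'n) module"
  where "direct_sum M N =
    \<lparr>carrier = carrier M \<times> carrier N, mult = undefined, one = undefined,
     zero = (\<zero>\<^bsub>M\<^esub>, \<zero>\<^bsub>N\<^esub>),
     add = (\<lambda>(x, y) (x', y'). (x \<oplus>\<^bsub>M\<^esub> x', y \<oplus>\<^bsub>N\<^esub> y')),
     smult = (\<lambda>r (x, y). (r \<odot>\<^bsub>M\<^esub> x, r \<odot>\<^bsub>N\<^esub> y))\<rparr>"


section \<open>Artin algebras\<close>

definition artinian_ring :: "('r, 'k) ring_scheme \<Rightarrow> bool"
  where "artinian_ring A \<longleftrightarrow>
    cring A \<and>
    (\<forall>I :: nat \<Rightarrow> 'r set. (\<forall>n. ideal (I n) A \<and> I (Suc n) \<subseteq> I n) \<longrightarrow>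
      (\<exists>n. \<forall>m\<ge>n. I m = I n))"

definition center_ring :: "('r, 'k) ring_scheme \<Rightarrow> ('r, 'k) ring_scheme"
  where "center_ring R =
    R\<lparr>carrier := {z \<in> carrier R. \<forall>x\<in>carrier R. z \<otimes>\<^bsub>R\<^esub> x = x \<otimes>\<^bsub>R\<^esub> z}\<rparr>"

text \<open>In the last conjunct only the central scalars act on \<open>regular_module R\<close>.\<close>

definition artin_algebra :: "('r, 'k) ring_scheme \<Rightarrow> bool"
  where "artin_algebra R \<longleftrightarrow>
    ring R \<and> artinian_ring (center_ring R) \<and>
    finitely_generated_module (center_ring R) (regular_module R)"


section \<open>The group \<open>Ext\<^sup>1\<close>\<close>

text \<open>
  \<open>Ext\<^sup>1(M, N)\<close> is the first cohomology group of \<open>Hom(F\<^sub>\<bullet>, N)\<close> for a projective resolution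
  \<open>F\<^sub>2 \<rightarrow> F\<^sub>1 \<rightarrow> F\<^sub>0 \<rightarrow> M \<rightarrow> 0\<close>. We use the canonical free resolution: \<open>F\<^sub>0\<close> is free on the
  elements of \<open>M\<close>, and each further term is free on the elements of the preceding kernel.
\<close>

definition free_module :: "('r, 'k) ring_scheme \<Rightarrow> 'x set \<Rightarrow> ('r, 'x \<Rightarrow> 'r) module"
  where "free_module R B =
    \<lparr>carrier = {f. (\<forall>x\<in>B. f x \<in> carrier R) \<and> (\<forall>x. x \<notin> B \<longrightarrow> f x = \<zero>\<^bsub>R\<^esub>) \<and>
                   finite {x. f x \<noteq> \<zero>\<^bsub>R\<^esub>}},
     mult = undefined, one = undefined,
     zero = (\<lambda>x. \<zero>\<^bsub>R\<^esub>),
     add = (\<lambda>f g x. f x \<oplus>\<^bsub>R\<^esub> g x),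
     smult = (\<lambda>r f x. r \<otimes>\<^bsub>R\<^esub> f x)\<rparr>"

text \<open>
  For \<open>B \<subseteq> carrier M\<close>, the linear map \<open>free_module R B \<rightarrow> M\<close> that sends the basis element
  indexed by \<open>x\<close> to \<open>x\<close>.
\<close>

definition free_eval :: "('r, 'k) ring_scheme \<Rightarrow> ('r, 'm) module \<Rightarrow> 'm set \<Rightarrow> ('m \<Rightarrow> 'r) \<Rightarrow> 'm"
  where "free_eval R M B =
    (\<lambda>f\<in>carrier (free_module R B). \<Oplus>\<^bsub>M\<^esub>x\<in>{x. f x \<noteq> \<zero>\<^bsub>R\<^esub>}. f x \<odot>\<^bsub>M\<^esub> x)"

definition res_F0 :: "('r, 'k) ring_scheme \<Rightarrow> ('r, 'm) module \<Rightarrow> ('r, 'm \<Rightarrow> 'r) module"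
  where "res_F0 R M = free_module R (carrier M)"

definition res_K0 :: "('r, 'k) ring_scheme \<Rightarrow> ('r, 'm) module \<Rightarrow> ('m \<Rightarrow> 'r) set"
  where "res_K0 R M = a_kernel (res_F0 R M) M (free_eval R M (carrier M))"

definition res_F1 :: "('r, 'k) ring_scheme \<Rightarrow> ('r, 'm) module \<Rightarrow> ('r, ('m \<Rightarrow> 'r) \<Rightarrow> 'r) module"
  where "res_F1 R M = free_module R (res_K0 R M)"

definition res_d1 :: "('r, 'k) ring_scheme \<Rightarrow> ('r, 'm) module \<Rightarrow> (('m \<Rightarrow> 'r) \<Rightarrow> 'r) \<Rightarrow> 'm \<Rightarrow> 'r"
  where "res_d1 R M = free_eval R (res_F0 R M) (res_K0 R M)"

definition res_K1 :: "('r, 'k) ring_scheme \<Rightarrow> ('r, 'm) module \<Rightarrow> (('m \<Rightarrow> 'r) \<Rightarrow> 'r) set"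
  where "res_K1 R M = a_kernel (res_F1 R M) (res_F0 R M) (res_d1 R M)"

definition res_F2 ::
    "('r, 'k) ring_scheme \<Rightarrow> ('r, 'm) module \<Rightarrow> ('r, (('m \<Rightarrow> 'r) \<Rightarrow> 'r) \<Rightarrow> 'r) module"
  where "res_F2 R M = free_module R (res_K1 R M)"

definition res_d2 ::
    "('r, 'k) ring_scheme \<Rightarrow> ('r, 'm) module \<Rightarrow> ((('m \<Rightarrow> 'r) \<Rightarrow> 'r) \<Rightarrow> 'r) \<Rightarrow> ('m \<Rightarrow> 'r) \<Rightarrow> 'r"
  where "res_d2 R M = free_eval R (res_F1 R M) (res_K1 R M)"

definition hom_group ::
    "('r, 'k) ring_scheme \<Rightarrow> ('r, 'm) module \<Rightarrow> ('r, 'n) module \<Rightarrow> ('m \<Rightarrow> 'n) monoid"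
  where "hom_group R M N =
    \<lparr>carrier = module_hom R M N,
     mult = (\<lambda>f g. \<lambda>x\<in>carrier M. f x \<oplus>\<^bsub>N\<^esub> g x),
     one = (\<lambda>x\<in>carrier M. \<zero>\<^bsub>N\<^esub>)\<rparr>"

definition ext1_cocycles ::
    "('r, 'k) ring_scheme \<Rightarrow> ('r, 'm) module \<Rightarrow> ('r, 'n) module \<Rightarrow> ((('m \<Rightarrow> 'r) \<Rightarrow> 'r) \<Rightarrow> 'n) set"
  where "ext1_cocycles R M N =
    kernel (hom_group R (res_F1 R M) N) (hom_group R (res_F2 R M) N)
      (\<lambda>f. compose (carrier (res_F2 R M)) f (res_d2 R M))"

definition ext1_coboundaries ::
    "('r, 'k) ring_scheme \<Rightarrow> ('r, 'm) module \<Rightarrow> ('r, 'n) module \<Rightarrow> ((('m \<Rightarrow> 'r) \<Rightarrow> 'r) \<Rightarrow> 'n) set"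
  where "ext1_coboundaries R M N =
    (\<lambda>f. compose (carrier (res_F1 R M)) f (res_d1 R M)) ` carrier (hom_group R (res_F0 R M) N)"

definition Ext1 ::
    "('r, 'k) ring_scheme \<Rightarrow> ('r, 'm) module \<Rightarrow> ('r, 'n) module \<Rightarrow>
      ((('m \<Rightarrow> 'r) \<Rightarrow> 'r) \<Rightarrow> 'n) set monoid"
  where "Ext1 R M N =
    (hom_group R (res_F1 R M) N)\<lparr>carrier := ext1_cocycles R M N\<rparr> Mod ext1_coboundaries R M N"

end

theory Submission
  imports Defs
begin

text \<open>
  Let \<open>a\<^sub>1, \<dots>, a\<^sub>n\<close> generate \<open>\<Lambda>\<close> over its centre and let \<open>s \<noteq> 0\<close> in \<open>S\<close>. As \<open>S = \<Lambda>s\<close>, an element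
  that kills all \<open>a\<^sub>i s\<close> kills \<open>S\<close>, so it is zero by faithfulness. In a minimal set of elements of
  \<open>S\<close> with zero annihilator, drop one element \<open>t\<close>: the annihilator \<open>I\<close> of the rest is a nonzero
  left ideal, and \<open>r \<mapsto> rt\<close> is an isomorphism from \<open>I\<close> onto the simple module \<open>S\<close>. This gives
  a nonzero linear \<open>\<phi> : S \<rightarrow> \<Lambda>\<close>. By faithfulness some \<open>u\<close> makes \<open>y \<mapsto> \<phi>(y)u\<close> a nonzero
  endomorphism of \<open>S\<close>, which is invertible by Schur's lemma. Composing \<open>\<phi>\<close> with its inverse
  gives a linear \<open>\<psi> : S \<rightarrow> \<Lambda>\<close> with \<open>\<psi>(y)u = y\<close>, a dual basis with one element.
\<close>

section \<open>Scalar arithmetic and submodules of a left module\<close>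

lemma (in abelian_group) eq_if_minus_eq_zero:
  assumes "x \<in> carrier G" "y \<in> carrier G" "x \<oplus> \<ominus> y = \<zero>"
  shows "x = y"
  using assms by (metis a_inv_closed minus_equality minus_minus)

context left_module
begin

lemma smult_r_null [simp]:
  assumes "a \<in> carrier R"
  shows "a \<odot>\<^bsub>M\<^esub> \<zero>\<^bsub>M\<^esub> = \<zero>\<^bsub>M\<^esub>"
proof -
  have "a \<odot>\<^bsub>M\<^esub> \<zero>\<^bsub>M\<^esub> \<oplus>\<^bsub>M\<^esub> a \<odot>\<^bsub>M\<^esub> \<zero>\<^bsub>M\<^esub> = a \<odot>\<^bsub>M\<^esub> \<zero>\<^bsub>M\<^esub> \<oplus>\<^bsub>M\<^esub> \<zero>\<^bsub>M\<^esub>"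
    using assms smult_r_distr[of a "\<zero>\<^bsub>M\<^esub>" "\<zero>\<^bsub>M\<^esub>"] by simp
  then show ?thesis
    using assms by simp
qed

lemma smult_l_null [simp]:
  assumes "x \<in> carrier M"
  shows "\<zero> \<odot>\<^bsub>M\<^esub> x = \<zero>\<^bsub>M\<^esub>"
proof -
  have "\<zero> \<odot>\<^bsub>M\<^esub> x \<oplus>\<^bsub>M\<^esub> \<zero> \<odot>\<^bsub>M\<^esub> x = \<zero> \<odot>\<^bsub>M\<^esub> x \<oplus>\<^bsub>M\<^esub> \<zero>\<^bsub>M\<^esub>"
    using assms smult_l_distr[of "\<zero>" "\<zero>" x] by simp
  then show ?thesis
    using assms by simp
qed

lemma smult_l_minus:
  assumes "a \<in> carrier R" "x \<in> carrier M"
  shows "(\<ominus> a) \<odot>\<^bsub>M\<^esub> x = \<ominus>\<^bsub>M\<^esub> (a \<odot>\<^bsub>M\<^esub> x)"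
proof -
  have "(\<ominus> a) \<odot>\<^bsub>M\<^esub> x \<oplus>\<^bsub>M\<^esub> a \<odot>\<^bsub>M\<^esub> x = \<zero>\<^bsub>M\<^esub>"
    using assms smult_l_distr[of "\<ominus> a" a x] by (simp add: R.l_neg)
  then show ?thesis
    using assms by (metis M.minus_equality R.a_inv_closed smult_closed)
qed

text \<open>Closure under negatives follows from closure under the scalar
  \<open>\<ominus> \<one>\<close>.\<close>

lemma submoduleI:
  assumes "N \<subseteq> carrier M" "\<zero>\<^bsub>M\<^esub> \<in> N"
    and add: "\<And>x y. x \<in> N \<Longrightarrow> y \<in> N \<Longrightarrow> x \<oplus>\<^bsub>M\<^esub> y \<in> N"
    and smult: "\<And>a x. a \<in> carrier R \<Longrightarrow> x \<in> N \<Longrightarrow> a \<odot>\<^bsub>M\<^esub> x \<in> N"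
  shows "submodule N R M"
proof -
  have "\<ominus>\<^bsub>M\<^esub> x \<in> N" if "x \<in> N" for x
    using smult[of "\<ominus> \<one>" x] that assms(1) smult_l_minus[of "\<one>" x] by auto
  then show ?thesis
    using assms unfolding submodule_def submodule_axioms_def
    by (auto intro!: subgroup.intro simp: a_inv_def)
qed

text \<open>The map \<open>r \<mapsto> r x\<close> is left linear, so it carries the left ideal
  \<open>I\<close> to a submodule. It serves twice below: with \<open>I\<close> the whole ring, to
  see that a simple module is cyclic, and with \<open>I\<close> the annihilator of a finite
  set.\<close>

lemma smult_image_submodule:
  assumes "I \<subseteq> carrier R" "\<zero> \<in> I" "x \<in> carrier M"
    and "\<And>a b. a \<in> I \<Longrightarrow> b \<in> I \<Longrightarrow> a \<oplus> b \<in> I"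
    and "\<And>r a. r \<in> carrier R \<Longrightarrow> a \<in> I \<Longrightarrow> r \<otimes> a \<in> I"
  shows "submodule ((\<lambda>r. r \<odot>\<^bsub>M\<^esub> x) ` I) R M"
proof (rule submoduleI)
  show "\<zero>\<^bsub>M\<^esub> \<in> (\<lambda>r. r \<odot>\<^bsub>M\<^esub> x) ` I"
    using assms by force
next
  fix y z assume "y \<in> (\<lambda>r. r \<odot>\<^bsub>M\<^esub> x) ` I" "z \<in> (\<lambda>r. r \<odot>\<^bsub>M\<^esub> x) ` I"
  then obtain a b where "a \<in> I" "b \<in> I" "y = a \<odot>\<^bsub>M\<^esub> x" "z = b \<odot>\<^bsub>M\<^esub> x"
    by auto
  then show "y \<oplus>\<^bsub>M\<^esub> z \<in> (\<lambda>r. r \<odot>\<^bsub>M\<^esub> x) ` I"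
    using assms by (intro image_eqI[where x = "a \<oplus> b"]) (auto simp: smult_l_distr subset_eq)
next
  fix r y assume "r \<in> carrier R" "y \<in> (\<lambda>r. r \<odot>\<^bsub>M\<^esub> x) ` I"
  then obtain a where "a \<in> I" "y = a \<odot>\<^bsub>M\<^esub> x"
    by auto
  then show "r \<odot>\<^bsub>M\<^esub> y \<in> (\<lambda>r. r \<odot>\<^bsub>M\<^esub> x) ` I"
    using assms \<open>r \<in> carrier R\<close>
    by (intro image_eqI[where x = "r \<otimes> a"]) (auto simp: smult_assoc1 subset_eq)
qed (use assms in auto)

text \<open>Central coefficients move to the left of \<open>r\<close>:
  \<open>r (c a) s = c (r a s)\<close>. Hence killing the finitely many elements \<open>a s\<close>
  already kills \<open>x s\<close> for every central combination \<open>x\<close> of the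
  \<open>a\<close>. This is where generation over the centre enters.\<close>

lemma annihilated_by_finsum:
  assumes reg: "left_module (center_ring R) (regular_module R)"
    and A: "finite A" "A \<subseteq> carrier R" and c: "c \<in> A \<rightarrow> carrier (center_ring R)"
    and r: "r \<in> carrier R" and s: "s \<in> carrier M"
    and null: "\<And>a. a \<in> A \<Longrightarrow> r \<odot>\<^bsub>M\<^esub> (a \<odot>\<^bsub>M\<^esub> s) = \<zero>\<^bsub>M\<^esub>"
  shows "r \<odot>\<^bsub>M\<^esub> ((\<Oplus>\<^bsub>regular_module R\<^esub>a\<in>A. c a \<odot>\<^bsub>regular_module R\<^esub> a) \<odot>\<^bsub>M\<^esub> s) = \<zero>\<^bsub>M\<^esub>"
proof -
  interpret reg: left_module "center_ring R" "regular_module R" by (rule reg)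
  have c': "c a \<in> carrier R" "c a \<otimes> x = x \<otimes> c a" if "a \<in> A" "x \<in> carrier R" for a x
    using c that by (auto simp: center_ring_def)
  have add: "x \<oplus>\<^bsub>regular_module R\<^esub> y = x \<oplus> y" and mult: "x \<odot>\<^bsub>regular_module R\<^esub> y = x \<otimes> y"
    and zero: "\<zero>\<^bsub>regular_module R\<^esub> = \<zero>" and carr: "carrier (regular_module R) = carrier R"
    for x y
    by (auto simp: regular_module_def)
  have term_null: "r \<odot>\<^bsub>M\<^esub> ((c a \<otimes> a) \<odot>\<^bsub>M\<^esub> s) = \<zero>\<^bsub>M\<^esub>" if a: "a \<in> A" for a
  proof -
    have ac: "a \<in> carrier R"
      using a A by auto
    have "r \<odot>\<^bsub>M\<^esub> ((c a \<otimes> a) \<odot>\<^bsub>M\<^esub> s) = (r \<otimes> c a) \<odot>\<^bsub>M\<^esub> (a \<odot>\<^bsub>M\<^esub> s)"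
      using c'(1)[OF a r] ac r s by (simp add: smult_assoc1)
    also have "\<dots> = c a \<odot>\<^bsub>M\<^esub> (r \<odot>\<^bsub>M\<^esub> (a \<odot>\<^bsub>M\<^esub> s))"
      using c'(1)[OF a r] c'(2)[OF a r, symmetric] ac r s by (simp add: smult_assoc1)
    finally show ?thesis
      using null[OF a] c'(1)[OF a r] by simp
  qed
  \<comment> \<open>Membership of the partial sum in \<open>carrier R\<close> is carried through the
    induction, because distributing over the sum requires it. The subset condition is kept since
    \<open>c\<close> is controlled only on \<open>A\<close>.\<close>
  have *: "(\<Oplus>\<^bsub>regular_module R\<^esub>a\<in>F. c a \<odot>\<^bsub>regular_module R\<^esub> a) \<in> carrier R \<and>
      r \<odot>\<^bsub>M\<^esub> ((\<Oplus>\<^bsub>regular_module R\<^esub>a\<in>F. c a \<odot>\<^bsub>regular_module R\<^esub> a) \<odot>\<^bsub>M\<^esub> s) = \<zero>\<^bsub>M\<^esub>"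
    if "finite F" "F \<subseteq> A" for F
    using that
  proof (induction F rule: finite_induct)
    case empty
    then show ?case
      using r s by (simp add: zero)
  next
    case (insert a F)
    have ca: "c a \<otimes> a \<in> carrier R"
      using c'(1)[of a] insert.prems A by auto
    have "(\<Oplus>\<^bsub>regular_module R\<^esub>a\<in>insert a F. c a \<odot>\<^bsub>regular_module R\<^esub> a) =
        c a \<otimes> a \<oplus> (\<Oplus>\<^bsub>regular_module R\<^esub>a\<in>F. c a \<odot>\<^bsub>regular_module R\<^esub> a)"
      using insert.hyps insert.prems ca c' A
      by (subst reg.M.finsum_insert) (auto simp: carr add mult subset_eq)
    then show ?case
      using insert ca r s term_null[of a] by (simp add: smult_l_distr smult_r_distr)
  qed
  show ?thesis
    using *[OF A(1) subset_refl] by blast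
qed

end

section \<open>Projectivity from a dual basis with one element\<close>

lemma projective_if_dual_basis:
  fixes R :: "('a, 'k) ring_scheme" (structure) and M :: "('a, 'b) module" (structure)
  assumes M: "left_module R M"
    and \<psi>: "\<psi> \<in> module_hom R M (regular_module R)" and u: "u \<in> carrier M"
    and \<psi>u: "\<And>y. y \<in> carrier M \<Longrightarrow> \<psi> y \<odot>\<^bsub>M\<^esub> u = y"
  shows "projective_module TYPE('x) TYPE('y) R M"
  unfolding projective_module_def
proof (intro conjI allI impI)
  show "left_module R M"
    by (rule M)
next
  fix A :: "('a, 'x) module" and B :: "('a, 'y) module" and g f
  assume A: "left_module R A" and g: "g \<in> module_hom R A B"
    and surj: "g ` carrier A = carrier B" and f: "f \<in> module_hom R M B"
  interpret left_module R M by (rule M)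
  interpret A: left_module R A by (rule A)
  have \<psi>_carr: "\<And>x. x \<in> carrier M \<Longrightarrow> \<psi> x \<in> carrier R"
    and \<psi>_add: "\<And>x y. x \<in> carrier M \<Longrightarrow> y \<in> carrier M \<Longrightarrow> \<psi> (x \<oplus>\<^bsub>M\<^esub> y) = \<psi> x \<oplus> \<psi> y"
    and \<psi>_lin: "\<And>r x. r \<in> carrier R \<Longrightarrow> x \<in> carrier M \<Longrightarrow> \<psi> (r \<odot>\<^bsub>M\<^esub> x) = r \<otimes> \<psi> x"
    using \<psi> by (auto simp: module_hom_def regular_module_def)
  have "f u \<in> carrier B"
    using f u by (auto simp: module_hom_def)
  \<comment> \<open>A preimage \<open>a\<close> of \<open>f u\<close> determines the lift
    \<open>y \<mapsto> \<psi> y a\<close>: applying \<open>g\<close> gives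
    \<open>\<psi> y (f u) = f (\<psi> y u) = f y\<close>. Linearity of the lift is inherited from
    \<open>\<psi>\<close>.\<close>
  then obtain a where a: "a \<in> carrier A" "g a = f u"
    using surj by (metis imageE)
  show "\<exists>h\<in>module_hom R M A. \<forall>p\<in>carrier M. g (h p) = f p"
  proof
    show "(\<lambda>y\<in>carrier M. \<psi> y \<odot>\<^bsub>A\<^esub> a) \<in> module_hom R M A"
      using a by (auto simp: module_hom_def \<psi>_carr \<psi>_add \<psi>_lin A.smult_l_distr A.smult_assoc1)
    have "g (\<psi> p \<odot>\<^bsub>A\<^esub> a) = f p" if p: "p \<in> carrier M" for p
    proof -
      have "g (\<psi> p \<odot>\<^bsub>A\<^esub> a) = \<psi> p \<odot>\<^bsub>B\<^esub> f u"
        using g a p \<psi>_carr by (auto simp: module_hom_def)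
      also have "\<dots> = f (\<psi> p \<odot>\<^bsub>M\<^esub> u)"
        using f u p \<psi>_carr by (auto simp: module_hom_def)
      finally show ?thesis
        using \<psi>u p by simp
    qed
    then show "\<forall>p\<in>carrier M. g ((\<lambda>y\<in>carrier M. \<psi> y \<odot>\<^bsub>A\<^esub> a) p) = f p"
      by simp
  qed
qed

section \<open>Simple modules: embedding into the ring, Schur's lemma, splitting\<close>

locale simple_left_module = left_module R M
  for R :: "('a, 'k) ring_scheme" (structure) and M :: "('a, 'b) module" (structure) +
  assumes simple: "simple_module R M"
begin

lemma submodule_eq_carrier:
  assumes "submodule N R M" "x \<in> N" "x \<noteq> \<zero>\<^bsub>M\<^esub>"
  shows "N = carrier M"
  using assms simple unfolding simple_module_def by auto

lemma cyclic:
  assumes "x \<in> carrier M" "x \<noteq> \<zero>\<^bsub>M\<^esub>" "y \<in> carrier M"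
  obtains r where "r \<in> carrier R" "y = r \<odot>\<^bsub>M\<^esub> x"
proof -
  have "submodule ((\<lambda>r. r \<odot>\<^bsub>M\<^esub> x) ` carrier R) R M"
    by (rule smult_image_submodule) (use assms in auto)
  moreover have "x \<in> (\<lambda>r. r \<odot>\<^bsub>M\<^esub> x) ` carrier R"
    using assms by (intro image_eqI[where x = "\<one>"]) auto
  ultimately have "(\<lambda>r. r \<odot>\<^bsub>M\<^esub> x) ` carrier R = carrier M"
    using assms submodule_eq_carrier by blast
  with assms(3) that show ?thesis by blast
qed

lemma embeds_in_regular:
  assumes "finite T" "T \<subseteq> carrier M"
    and "\<And>r. r \<in> carrier R \<Longrightarrow> (\<And>t. t \<in> T \<Longrightarrow> r \<odot>\<^bsub>M\<^esub> t = \<zero>\<^bsub>M\<^esub>) \<Longrightarrow> r = \<zero>"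
  shows "\<exists>\<phi> \<in> module_hom R M (regular_module R). \<exists>y \<in> carrier M. \<phi> y \<noteq> \<zero>"
  using assms
proof (induction T rule: finite_induct)
  \<comment> \<open>Every scalar kills the empty set, so \<open>\<one> = \<zero>\<close>, and the
    module would be zero, contrary to simplicity.\<close>
  case empty
  have "\<one> = \<zero>"
    using empty by auto
  then have "x = \<zero>\<^bsub>M\<^esub>" if "x \<in> carrier M" for x
    using that by (metis smult_l_null smult_one)
  then have False
    using simple M.zero_closed unfolding simple_module_def by blast
  then show ?case ..
next
  case (insert s T)
  define I where "I = {r \<in> carrier R. \<forall>t\<in>T. r \<odot>\<^bsub>M\<^esub> t = \<zero>\<^bsub>M\<^esub>}"
  have s: "s \<in> carrier M" and T: "\<And>t. t \<in> T \<Longrightarrow> t \<in> carrier M"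
    using insert.prems by auto
  have I_carr: "\<And>r. r \<in> I \<Longrightarrow> r \<in> carrier R"
    by (auto simp: I_def)
  have I_add: "\<And>a b. a \<in> I \<Longrightarrow> b \<in> I \<Longrightarrow> a \<oplus> b \<in> I"
    using T by (auto simp: I_def smult_l_distr)
  have I_mult: "\<And>r a. r \<in> carrier R \<Longrightarrow> a \<in> I \<Longrightarrow> r \<otimes> a \<in> I"
    using T by (auto simp: I_def smult_assoc1)
  have I_minus: "\<And>a. a \<in> I \<Longrightarrow> \<ominus> a \<in> I"
    using T by (auto simp: I_def smult_l_minus)
  have I_zero: "\<zero> \<in> I"
    using T by (auto simp: I_def)
  show ?case
  proof (cases "I = {\<zero>}")
    case True
    then have "r = \<zero>" if "r \<in> carrier R" "\<And>t. t \<in> T \<Longrightarrow> r \<odot>\<^bsub>M\<^esub> t = \<zero>\<^bsub>M\<^esub>" for r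
      using that by (auto simp: I_def)
    then show ?thesis
      using insert.IH insert.prems(1) by blast
  next
    case False
    then obtain i where i: "i \<in> I" "i \<noteq> \<zero>"
      using I_zero by auto
    \<comment> \<open>The kernel of \<open>r \<mapsto> r s\<close> on \<open>I\<close> is the
      annihilator of \<open>insert s T\<close>, which is zero by assumption.\<close>
    have inj0: "a = \<zero>" if "a \<in> I" "a \<odot>\<^bsub>M\<^esub> s = \<zero>\<^bsub>M\<^esub>" for a
      using insert.prems(2)[of a] that by (auto simp: I_def)
    have inj: "a = b" if "a \<in> I" "b \<in> I" "a \<odot>\<^bsub>M\<^esub> s = b \<odot>\<^bsub>M\<^esub> s" for a b
    proof -
      have "(a \<oplus> \<ominus> b) \<odot>\<^bsub>M\<^esub> s = \<zero>\<^bsub>M\<^esub>"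
        using that s by (simp add: smult_l_distr smult_l_minus I_carr M.r_neg)
      then have "a \<oplus> \<ominus> b = \<zero>"
        using inj0 that I_add I_minus by blast
      then show ?thesis
        using that I_carr R.eq_if_minus_eq_zero by blast
    qed
    have "submodule ((\<lambda>r. r \<odot>\<^bsub>M\<^esub> s) ` I) R M"
      by (rule smult_image_submodule) (use s I_carr I_add I_mult I_zero in auto)
    then have surj: "(\<lambda>r. r \<odot>\<^bsub>M\<^esub> s) ` I = carrier M"
      by (rule submodule_eq_carrier[OF _ imageI[OF i(1)]]) (use i inj0 in auto)
    \<comment> \<open>The inverse of the bijection \<open>r \<mapsto> r s\<close> from
      \<open>I\<close> onto the module. Its linearity is checked by writing each argument as
      \<open>a s\<close> with \<open>a\<close> in \<open>I\<close>.\<close>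
    define \<phi> where "\<phi> = (\<lambda>y\<in>carrier M. the_inv_into I (\<lambda>r. r \<odot>\<^bsub>M\<^esub> s) y)"
    have inj_on: "inj_on (\<lambda>r. r \<odot>\<^bsub>M\<^esub> s) I"
      using inj by (auto intro: inj_onI)
    have \<phi>: "\<phi> (r \<odot>\<^bsub>M\<^esub> s) = r" if "r \<in> I" for r
      using that s I_carr the_inv_into_f_f[OF inj_on that] by (simp add: \<phi>_def)
    have "\<phi> (x \<oplus>\<^bsub>M\<^esub> y) = \<phi> x \<oplus> \<phi> y" if xy: "x \<in> carrier M" "y \<in> carrier M" for x y
    proof -
      obtain a b where ab: "a \<in> I" "b \<in> I" "x = a \<odot>\<^bsub>M\<^esub> s" "y = b \<odot>\<^bsub>M\<^esub> s"
        using xy surj by blast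
      then have "x \<oplus>\<^bsub>M\<^esub> y = (a \<oplus> b) \<odot>\<^bsub>M\<^esub> s"
        using s I_carr by (simp add: smult_l_distr)
      then show ?thesis
        using \<phi> ab I_add by simp
    qed
    moreover have "\<phi> (r \<odot>\<^bsub>M\<^esub> x) = r \<otimes> \<phi> x" if rx: "r \<in> carrier R" "x \<in> carrier M" for r x
    proof -
      obtain a where a: "a \<in> I" "x = a \<odot>\<^bsub>M\<^esub> s"
        using rx surj by blast
      then have "r \<odot>\<^bsub>M\<^esub> x = (r \<otimes> a) \<odot>\<^bsub>M\<^esub> s"
        using s I_carr rx by (simp add: smult_assoc1)
      then show ?thesis
        using \<phi> a I_mult rx by simp
    qed
    moreover have "\<phi> \<in> carrier M \<rightarrow>\<^sub>E carrier R"
    proof -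
      have "\<phi> x \<in> carrier R" if x: "x \<in> carrier M" for x
      proof -
        obtain a where "a \<in> I" "x = a \<odot>\<^bsub>M\<^esub> s"
          using x surj by blast
        then show ?thesis
          using \<phi> I_carr by simp
      qed
      then show ?thesis
        by (auto simp: \<phi>_def)
    qed
    ultimately have "\<phi> \<in> module_hom R M (regular_module R)"
      by (simp add: module_hom_def regular_module_def)
    moreover have "\<phi> (i \<odot>\<^bsub>M\<^esub> s) \<noteq> \<zero>" "i \<odot>\<^bsub>M\<^esub> s \<in> carrier M"
      using \<phi> i s I_carr by auto
    ultimately show ?thesis
      by blast
  qed
qed

text \<open>Schur's lemma: the image contains the nonzero element \<open>\<theta> y\<close>, so it
  is everything; the kernel misses \<open>y\<close>, so it is zero.\<close>

lemma endo_bij: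
  assumes \<theta>: "\<theta> \<in> module_hom R M M"
    and y: "y \<in> carrier M" "\<theta> y \<noteq> \<zero>\<^bsub>M\<^esub>"
  shows "bij_betw \<theta> (carrier M) (carrier M)"
proof -
  have carr: "\<And>x. x \<in> carrier M \<Longrightarrow> \<theta> x \<in> carrier M"
    and add: "\<And>x y. x \<in> carrier M \<Longrightarrow> y \<in> carrier M \<Longrightarrow> \<theta> (x \<oplus>\<^bsub>M\<^esub> y) = \<theta> x \<oplus>\<^bsub>M\<^esub> \<theta> y"
    and lin: "\<And>r x. r \<in> carrier R \<Longrightarrow> x \<in> carrier M \<Longrightarrow> \<theta> (r \<odot>\<^bsub>M\<^esub> x) = r \<odot>\<^bsub>M\<^esub> \<theta> x"
    using \<theta> by (auto simp: module_hom_def)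
  have zero: "\<theta> \<zero>\<^bsub>M\<^esub> = \<zero>\<^bsub>M\<^esub>"
    using lin[of \<zero> "\<zero>\<^bsub>M\<^esub>"] carr[of "\<zero>\<^bsub>M\<^esub>"] by simp
  have "submodule (\<theta> ` carrier M) R M"
  proof (rule submoduleI)
    show "\<zero>\<^bsub>M\<^esub> \<in> \<theta> ` carrier M"
      using zero by force
  next
    fix u v assume "u \<in> \<theta> ` carrier M" "v \<in> \<theta> ` carrier M"
    then obtain x y where "x \<in> carrier M" "y \<in> carrier M" "u = \<theta> x" "v = \<theta> y"
      by auto
    then show "u \<oplus>\<^bsub>M\<^esub> v \<in> \<theta> ` carrier M"
      by (intro image_eqI[where x = "x \<oplus>\<^bsub>M\<^esub> y"]) (simp_all add: add)
  next
    fix r u assume "r \<in> carrier R" "u \<in> \<theta> ` carrier M"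
    then obtain x where "x \<in> carrier M" "u = \<theta> x"
      by auto
    then show "r \<odot>\<^bsub>M\<^esub> u \<in> \<theta> ` carrier M"
      using \<open>r \<in> carrier R\<close> by (intro image_eqI[where x = "r \<odot>\<^bsub>M\<^esub> x"]) (simp_all add: lin)
  qed (use carr in auto)
  then have surj: "\<theta> ` carrier M = carrier M"
    by (rule submodule_eq_carrier[OF _ imageI[OF y(1), of \<theta>] y(2)])
  define K where "K = {x \<in> carrier M. \<theta> x = \<zero>\<^bsub>M\<^esub>}"
  have "submodule K R M"
    by (rule submoduleI) (auto simp: K_def zero add lin)
  moreover have "K \<noteq> carrier M"
    using y by (auto simp: K_def)
  ultimately have K: "K = {\<zero>\<^bsub>M\<^esub>}"
    using simple by (auto simp: simple_module_def)
  have "x = x'" if x: "x \<in> carrier M" "x' \<in> carrier M" "\<theta> x = \<theta> x'" for x x'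
  proof -
    have "\<theta> (x \<oplus>\<^bsub>M\<^esub> \<ominus>\<^bsub>M\<^esub> x') = \<theta> (x' \<oplus>\<^bsub>M\<^esub> \<ominus>\<^bsub>M\<^esub> x')"
      using x add by simp
    then have "x \<oplus>\<^bsub>M\<^esub> \<ominus>\<^bsub>M\<^esub> x' \<in> K"
      using x zero by (simp add: K_def M.r_neg)
    then have "x \<oplus>\<^bsub>M\<^esub> \<ominus>\<^bsub>M\<^esub> x' = \<zero>\<^bsub>M\<^esub>"
      using K by blast
    then show ?thesis
      using x M.eq_if_minus_eq_zero by blast
  qed
  then show ?thesis
    using surj by (auto simp: bij_betw_def intro: inj_onI)
qed

lemma projective_if_faithful:
  assumes faithful: "faithful_module R M"
    and \<phi>: "\<phi> \<in> module_hom R M (regular_module R)" and y: "y \<in> carrier M" "\<phi> y \<noteq> \<zero>"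
  shows "projective_module TYPE('x) TYPE('y) R M"
proof -
  have \<phi>_carr: "\<And>x. x \<in> carrier M \<Longrightarrow> \<phi> x \<in> carrier R"
    and \<phi>_add: "\<And>x y. x \<in> carrier M \<Longrightarrow> y \<in> carrier M \<Longrightarrow> \<phi> (x \<oplus>\<^bsub>M\<^esub> y) = \<phi> x \<oplus> \<phi> y"
    and \<phi>_lin: "\<And>r x. r \<in> carrier R \<Longrightarrow> x \<in> carrier M \<Longrightarrow> \<phi> (r \<odot>\<^bsub>M\<^esub> x) = r \<otimes> \<phi> x"
    using \<phi> by (auto simp: module_hom_def regular_module_def)
  \<comment> \<open>The value \<open>\<phi> y\<close> is a nonzero scalar, so by faithfulness it
    acts nontrivially on some \<open>u\<close>.\<close>
  have "\<phi> y \<notin> annihilator R M"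
    using y faithful by (simp add: faithful_module_def)
  then obtain u where u: "u \<in> carrier M" "\<phi> y \<odot>\<^bsub>M\<^esub> u \<noteq> \<zero>\<^bsub>M\<^esub>"
    using y \<phi>_carr by (auto simp: annihilator_def)
  define \<theta> where "\<theta> = (\<lambda>x\<in>carrier M. \<phi> x \<odot>\<^bsub>M\<^esub> u)"
  have \<theta>: "\<theta> \<in> module_hom R M M"
    using u by (auto simp: module_hom_def \<theta>_def \<phi>_carr \<phi>_add \<phi>_lin smult_l_distr smult_assoc1)
  have bij: "bij_betw \<theta> (carrier M) (carrier M)"
    using endo_bij[OF \<theta> y(1)] y(1) u(2) by (simp add: \<theta>_def)
  define \<theta>' where "\<theta>' = inv_into (carrier M) \<theta>"
  have \<theta>'_carr: "\<theta>' x \<in> carrier M" and \<theta>_\<theta>': "\<theta> (\<theta>' x) = x" if "x \<in> carrier M" for x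
    using bij that by (auto simp: \<theta>'_def bij_betw_def f_inv_into_f intro: inv_into_into)
  \<comment> \<open>Injectivity reduces linearity of the inverse \<open>\<theta>'\<close> to that of
    \<open>\<theta>\<close>: both sides of each equation have the same image under
    \<open>\<theta>\<close>.\<close>
  have inj: "x = x'" if "x \<in> carrier M" "x' \<in> carrier M" "\<theta> x = \<theta> x'" for x x'
    using bij that by (auto simp: bij_betw_def dest: inj_onD)
  have \<theta>'_add: "\<theta>' (x \<oplus>\<^bsub>M\<^esub> x') = \<theta>' x \<oplus>\<^bsub>M\<^esub> \<theta>' x'"
    if "x \<in> carrier M" "x' \<in> carrier M" for x x'
    by (rule inj) (use that \<theta> \<theta>'_carr \<theta>_\<theta>' in \<open>auto simp: module_hom_def\<close>)
  have \<theta>'_lin: "\<theta>' (r \<odot>\<^bsub>M\<^esub> x) = r \<odot>\<^bsub>M\<^esub> \<theta>' x"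
    if "r \<in> carrier R" "x \<in> carrier M" for r x
    by (rule inj) (use that \<theta> \<theta>'_carr \<theta>_\<theta>' in \<open>auto simp: module_hom_def\<close>)
  \<comment> \<open>This composite is the \<open>\<psi>\<close> of the dual basis, since
    \<open>\<phi> (\<theta>' x) u = \<theta> (\<theta>' x) = x\<close>.\<close>
  have "(\<lambda>x\<in>carrier M. \<phi> (\<theta>' x)) \<in> module_hom R M (regular_module R)"
    by (auto simp: module_hom_def regular_module_def \<theta>'_carr \<phi>_carr \<theta>'_add \<phi>_add \<theta>'_lin \<phi>_lin)
  moreover have "(\<lambda>x\<in>carrier M. \<phi> (\<theta>' x)) x \<odot>\<^bsub>M\<^esub> u = x" if "x \<in> carrier M" for x
    using \<theta>_\<theta>'[OF that] \<theta>'_carr[OF that] that by (simp add: \<theta>_def)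
  ultimately show ?thesis
    using u(1) projective_if_dual_basis[OF left_module_axioms] by blast
qed

end

section \<open>Faithful simple modules over Artin algebras\<close>

theorem proposition3p7:
  fixes \<Lambda> :: "('r, 'k) ring_scheme" and S :: "('r, 's) module"
  assumes "artin_algebra \<Lambda>"
    and "faithful_module \<Lambda> S"
    and "simple_module \<Lambda> S"
    and "trivial_group (Ext1 \<Lambda> (direct_sum S (regular_module \<Lambda>)) (direct_sum S (regular_module \<Lambda>)))"
  shows "projective_module TYPE('x) TYPE('y) \<Lambda> S"
proof -
  interpret simple_left_module \<Lambda> S
    using assms(3) by (simp add: simple_left_module_def simple_left_module_axioms_def simple_module_def)
  obtain s where s: "s \<in> carrier S" "s \<noteq> \<zero>\<^bsub>S\<^esub>"
    using assms(3) M.zero_closed unfolding simple_module_def by blast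
  from assms(1) obtain A where reg: "left_module (center_ring \<Lambda>) (regular_module \<Lambda>)"
    and A: "finite A" "A \<subseteq> carrier \<Lambda>"
    and gen: "\<And>x. x \<in> carrier \<Lambda> \<Longrightarrow> \<exists>c\<in>A \<rightarrow> carrier (center_ring \<Lambda>).
      x = (\<Oplus>\<^bsub>regular_module \<Lambda>\<^esub>a\<in>A. c a \<odot>\<^bsub>regular_module \<Lambda>\<^esub> a)"
    by (auto simp: artin_algebra_def finitely_generated_module_def regular_module_def)
  have "\<exists>\<phi> \<in> module_hom \<Lambda> S (regular_module \<Lambda>). \<exists>y \<in> carrier S. \<phi> y \<noteq> \<zero>\<^bsub>\<Lambda>\<^esub>"
  proof (rule embeds_in_regular)
    \<comment> \<open>The finite test set consists of the central generators of the algebra applied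
      to \<open>s\<close>.\<close>
    show "finite ((\<lambda>a. a \<odot>\<^bsub>S\<^esub> s) ` A)" "(\<lambda>a. a \<odot>\<^bsub>S\<^esub> s) ` A \<subseteq> carrier S"
      using A s by auto
    fix r assume r: "r \<in> carrier \<Lambda>" "\<And>t. t \<in> (\<lambda>a. a \<odot>\<^bsub>S\<^esub> s) ` A \<Longrightarrow> r \<odot>\<^bsub>S\<^esub> t = \<zero>\<^bsub>S\<^esub>"
    \<comment> \<open>Since \<open>s\<close> generates the simple module, \<open>y = x s\<close>;
      expanding \<open>x\<close> in the generators leaves only terms killed by
      \<open>r\<close>.\<close>
    have "r \<odot>\<^bsub>S\<^esub> y = \<zero>\<^bsub>S\<^esub>" if y: "y \<in> carrier S" for y
    proof -
      obtain x where x: "x \<in> carrier \<Lambda>" "y = x \<odot>\<^bsub>S\<^esub> s"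
        using cyclic[OF s y] .
      from gen[OF x(1)] obtain c where c: "c \<in> A \<rightarrow> carrier (center_ring \<Lambda>)"
        "x = (\<Oplus>\<^bsub>regular_module \<Lambda>\<^esub>a\<in>A. c a \<odot>\<^bsub>regular_module \<Lambda>\<^esub> a)"
        by blast
      show ?thesis
        unfolding x(2) c(2) using annihilated_by_finsum[OF reg A c(1) r(1) s(1)] r(2) by blast
    qed
    then have "r \<in> annihilator \<Lambda> S"
      using r(1) by (simp add: annihilator_def)
    then show "r = \<zero>\<^bsub>\<Lambda>\<^esub>"
      using assms(2) by (simp add: faithful_module_def)
  qed
  then show ?thesis
    using projective_if_faithful[OF assms(2)] by blast
qed

end
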